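(* Let $(G,p)$ be a bar-joint framework in $\mathbb{R}^d$ with $n$ distinct joints and $m$ bars, and with spatial symmetry group $\mathcal{G}$ with orthogonal representation $\rho_{sp}$ in $\mathbb{R}^d$. Let $\rho_n,\rho_e$ be the joint and bar permutation representations of $\mathcal{G}$ on $\mathbb{R}^n$ and $\mathbb{R}^m$ respectively, let $\rho_{rig}$ be the subrepresentation of $\rho_n\otimes\rho_{sp}$ on the space of trivial infinitesimal flexes, let $\rho_{mech}$ be the subrepresentation of $\rho_n\otimes\rho_{sp}$ for nontrivial flexes, and let $\rho_{st}$ be the subrepresentation of $\rho_e$ on the space of internal stresses. Then $$[\rho_{mech}]-[\rho_{st}]=[\rho_n]\cdot[\rho_{sp}]-[\rho_e]-[\rho_{rig}],$$ where $[\rho]$ denotes the character list of $\rho$ and $\cdot$ is the entrywise product of characters; that is, for every $g\in\mathcal{G}$, $$\operatorname{trace}\rho_{mech}(g)-\operatorname{trace}\rho_{st}(g)=\operatorname{trace}\rho_n(g)\,\operatorname{trace}\rho_{sp}(g)-\operatorname{trace}\rho_e(g)-\operatorname{trace}\rho_{rig}(g).$$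
   Context: A bar-joint framework $(G,p)$ in $\mathbb{R}^d$ consists of a finite connected simple graph $G=(V,E)$ with ordered vertices $v_1,\dots,v_n$ (joints) and edges $e_1,\dots,e_m$ (bars), and a vector $p=(p_1,\dots,p_n)$ of points of $\mathbb{R}^d$ (here distinct). Set $\mathcal{H}_v=\mathbb{R}^n\otimes\mathbb{R}^d$ (one copy of $\mathbb{R}^d$ per vertex) and $\mathcal{H}_e=\mathbb{R}^m$, with standard inner products. The rigidity matrix $R=R(G,p):\mathcal{H}_v\to\mathcal{H}_e$ has, in the row of the edge $e=(v_i,v_j)$, the row vector $p_i-p_j$ in the $d$ columns of $v_i$, $p_j-p_i$ in the $d$ columns of $v_j$, and zeros elsewhere. The spatial symmetry group $\mathcal{G}$ is the group of $g=(\sigma,T)$ where $\sigma$ is an automorphism of $G$ (regarded also as a permutation of $\{1,\dots,n\}$) and $T$ is an isometry of $\mathbb{R}^d$ with $p_{\sigma(i)}=Tp_i$ for all $i$. For such $g$: $\rho_{sp}(g)\in O(d)$ is the linear part of $T$; $\rho_n(g)$ sends the $i$-th standard basis vector to the $\sigma(i)$-th; $\rho_e(g)$ sends the basis vector of an edge $f$ to that of $\sigma(f)$. The representation of $\mathcal{G}$ on $\mathcal{H}_v$ is $\hat\rho_v=\rho_n\otimes\rho_{sp}$. The spaces are as follows. $\mathcal{H}_{fl}=\ker R$ is the space of infinitesimal flexes. $\mathcal{H}_{rig}\subseteq\mathcal{H}_{fl}$ is the space of trivial flexes arising from ambient rigid body motion, i.e. all vectors $(Ap_i+b)_{i=1}^n$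 with $A$ a skew-symmetric $d\times d$ matrix and $b\in\mathbb{R}^d$. $\mathcal{H}_{mech}$ is the orthogonal complement of $\mathcal{H}_{rig}$ in $\mathcal{H}_{fl}$. $\mathcal{H}_{st}=\ker R^{*}\subseteq\mathcal{H}_e$ is the space of self stresses. The spaces $\mathcal{H}_{rig},\mathcal{H}_{mech}$ are invariant under $\hat\rho_v$ and $\mathcal{H}_{st}$ is invariant under $\rho_e$; $\rho_{rig},\rho_{mech},\rho_{st}$ are the corresponding restrictions (a representation on the zero space has trace $0$). *)

theory Defs
  imports "HOL-Analysis.Analysis" "HOL-Algebra.Group"
begin

section \<open>Trace of an operator on an invariant subspace\<close>

text \<open>The trace of the restriction of \<open>f\<close> to a subspace \<open>S\<close> with \<open>f ` S \<subseteq> S\<close>: the sum of the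
  diagonal coefficients in some basis of \<open>S\<close>. The choice is immaterial by \<open>trace_on_basis\<close> below.\<close>

definition trace_on :: "'a::euclidean_space set \<Rightarrow> ('a \<Rightarrow> 'a) \<Rightarrow> real" where
  "trace_on S f =
     (let B = (SOME B. independent B \<and> span B = S) in \<Sum>b\<in>B. representation B (f b) b)"

lemma trace_on_basis:
  fixes f :: "'a::euclidean_space \<Rightarrow> 'a"
  assumes f: "linear f" "f ` S \<subseteq> S" and B: "independent B" "span B = S"
  shows "trace_on S f = (\<Sum>b\<in>B. representation B (f b) b)"
proof -
  define C where "C = (SOME C. independent C \<and> span C = S)"
  have C: "independent C" "span C = S"
    using someI[of "\<lambda>C. independent C \<and> span C = S" B] B unfolding C_def by auto
  have fin: "finite B" "finite C"
    using B C independent_imp_finite by auto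
  have inS: "f b \<in> S" if "b \<in> S" for b
    using that f by auto
  have BS: "b \<in> S" if "b \<in> B" for b
    using that B span_base by auto
  have CS: "c \<in> S" if "c \<in> C" for c
    using that C span_base by auto
  have *: "representation B (f b) b = (\<Sum>c\<in>C. representation C b c * representation B (f c) b)"
    if b: "b \<in> B" for b
  proof -
    have "f b = f (\<Sum>c\<in>C. representation C b c *\<^sub>R c)"
      using real_vector.sum_representation_eq[of C b C] C fin BS[OF b] by simp
    also have "\<dots> = (\<Sum>c\<in>C. representation C b c *\<^sub>R f c)"
      using f by (simp add: linear_sum linear_cmul)
    finally have "representation B (f b) b =
        representation B (\<Sum>c\<in>C. representation C b c *\<^sub>R f c) b" by simp
    also have "\<dots> = (\<Sum>c\<in>C. representation B (representation C b c *\<^sub>R f c) b)"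
      using real_vector.representation_sum[of B C "\<lambda>c. representation C b c *\<^sub>R f c"]
        B CS inS by (auto simp: span_scale)
    also have "\<dots> = (\<Sum>c\<in>C. representation C b c * representation B (f c) b)"
      using B CS inS by (intro sum.cong) (auto simp: real_vector.representation_scale)
    finally show ?thesis .
  qed
  have **: "(\<Sum>b\<in>B. representation C b c * representation B (f c) b) = representation C (f c) c"
    if c: "c \<in> C" for c
  proof -
    have "f c = (\<Sum>b\<in>B. representation B (f c) b *\<^sub>R b)"
      using real_vector.sum_representation_eq[of B "f c" B] B fin inS CS[OF c] by simp
    hence "representation C (f c) c = representation C (\<Sum>b\<in>B. representation B (f c) b *\<^sub>R b) c"
      by simp
    also have "\<dots> = (\<Sum>b\<in>B. representation C (representation B (f c) b *\<^sub>R b) c)"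
      using real_vector.representation_sum[of C B "\<lambda>b. representation B (f c) b *\<^sub>R b"]
        C BS by (auto simp: span_scale)
    also have "\<dots> = (\<Sum>b\<in>B. representation C b c * representation B (f c) b)"
      using C BS by (intro sum.cong) (auto simp: real_vector.representation_scale)
    finally show ?thesis by simp
  qed
  have "(\<Sum>b\<in>B. representation B (f b) b) =
      (\<Sum>b\<in>B. \<Sum>c\<in>C. representation C b c * representation B (f c) b)"
    using * by simp
  also have "\<dots> = (\<Sum>c\<in>C. \<Sum>b\<in>B. representation C b c * representation B (f c) b)"
    by (rule sum.swap)
  also have "\<dots> = (\<Sum>c\<in>C. representation C (f c) c)"
    using ** by simp
  also have "\<dots> = trace_on S f"
    by (simp add: trace_on_def C_def Let_def)
  finally show ?thesis by simp
qed

section \<open>Frameworks and the rigidity matrix\<close>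

text \<open>The joints are the elements of the finite type \<open>'n\<close>, the bars are two-element sets of
  joints, and the ambient space is \<open>real ^ 'd\<close>.\<close>

definition bar_joint_framework :: "'n::finite set set \<Rightarrow> ('n \<Rightarrow> real ^ 'd) \<Rightarrow> bool" where
  "bar_joint_framework E p \<longleftrightarrow>
     (\<forall>e\<in>E. card e = 2) \<and>
     (\<forall>i j. (i, j) \<in> {(u, v). {u, v} \<in> E}\<^sup>*) \<and>
     inj p"

text \<open>\<open>\<H>\<^sub>v\<close> is \<open>real ^ ('n \<times> 'd)\<close>, with the tensor of \<open>a\<close> and \<open>x\<close> having the coordinate
  \<open>a $ i * x $ k\<close> at \<open>(i, k)\<close>. Since the number of bars is not a type, \<open>\<H>\<^sub>e\<close> is the coordinate
  subspace of \<open>real ^ ('n set)\<close> spanned by the basis vectors of the bars; the rows of the rigidity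
  matrix that do not belong to bars are zero.\<close>

definition edge_space :: "'n::finite set set \<Rightarrow> (real ^ ('n set)) set" where
  "edge_space E = {w. \<forall>f. f \<notin> E \<longrightarrow> w $ f = 0}"

text \<open>For a bar \<open>e = {i, j}\<close> the inner sum has a single term, namely \<open>p i - p j\<close> in the columns
  of \<open>i\<close> and \<open>p j - p i\<close> in the columns of \<open>j\<close>.\<close>

definition rigidity_matrix ::
    "'n::finite set set \<Rightarrow> ('n \<Rightarrow> real ^ 'd) \<Rightarrow> real ^ ('n \<times> 'd) ^ ('n set)" where
  "rigidity_matrix E p =
     (\<chi> e ik. if e \<in> E \<and> fst ik \<in> e
              then (\<Sum>j\<in>e - {fst ik}. p (fst ik) - p j) $ snd ik else 0)"

definition inf_flexes :: "'n::finite set set \<Rightarrow> ('n \<Rightarrow> real ^ 'd) \<Rightarrow> (real ^ ('n \<times> 'd)) set" where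
  "inf_flexes E p = {u. rigidity_matrix E p *v u = 0}"

definition rigid_flexes :: "('n::finite \<Rightarrow> real ^ 'd) \<Rightarrow> (real ^ ('n \<times> 'd)) set" where
  "rigid_flexes p =
     {(\<chi> ik. (A *v p (fst ik) + b) $ snd ik) | A b. transpose A = - A}"

definition mech_flexes :: "'n::finite set set \<Rightarrow> ('n \<Rightarrow> real ^ 'd) \<Rightarrow> (real ^ ('n \<times> 'd)) set" where
  "mech_flexes E p = inf_flexes E p \<inter> orthogonal_comp (rigid_flexes p)"

definition self_stresses :: "'n::finite set set \<Rightarrow> ('n \<Rightarrow> real ^ 'd) \<Rightarrow> (real ^ ('n set)) set" where
  "self_stresses E p = {w \<in> edge_space E. transpose (rigidity_matrix E p) *v w = 0}"

section \<open>The spatial symmetry group and its representations\<close>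

definition spatial_symmetry_group :: "'n::finite set set \<Rightarrow> ('n \<Rightarrow> real ^ 'd) \<Rightarrow>
    (('n \<Rightarrow> 'n) \<times> (real ^ 'd \<Rightarrow> real ^ 'd)) monoid" where
  "spatial_symmetry_group E p =
     \<lparr>carrier = {(\<sigma>, T). bij \<sigma> \<and> (\<forall>i j. {\<sigma> i, \<sigma> j} \<in> E \<longleftrightarrow> {i, j} \<in> E) \<and>
                         (\<forall>x y. dist (T x) (T y) = dist x y) \<and>
                         (\<forall>i. p (\<sigma> i) = T (p i))},
      mult = (\<lambda>(\<sigma>, T) (\<tau>, S). (\<sigma> \<circ> \<tau>, T \<circ> S)),
      one = (id, id)\<rparr>"

lemma bij_of_isometry:
  fixes T :: "real ^ 'd \<Rightarrow> real ^ 'd"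
  assumes T: "\<And>x y. dist (T x) (T y) = dist x y"
  shows "bij T"
proof -
  have "orthogonal_transformation (\<lambda>x. T x - T 0)"
    unfolding orthogonal_transformation_isometry using T by (simp add: dist_norm)
  hence "bij (\<lambda>x. T x - T 0)" by (rule orthogonal_transformation_bij)
  moreover have "T = (\<lambda>y. y + T 0) \<circ> (\<lambda>x. T x - T 0)" by auto
  moreover have "bij (\<lambda>y. y + T 0)" by (rule bij_plus_right)
  ultimately show ?thesis using bij_comp by metis
qed

lemma group_spatial_symmetry_group: "group (spatial_symmetry_group E p)"
proof (rule groupI)
  fix g assume "g \<in> carrier (spatial_symmetry_group E p)"
  then obtain \<sigma> T where g: "g = (\<sigma>, T)" and s: "bij \<sigma>"
      "\<And>i j. {\<sigma> i, \<sigma> j} \<in> E \<longleftrightarrow> {i, j} \<in> E"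
    and T: "\<And>x y. dist (T x) (T y) = dist x y" "\<And>i. p (\<sigma> i) = T (p i)"
    by (auto simp: spatial_symmetry_group_def)
  have bT: "bij T" using T(1) by (rule bij_of_isometry)
  have sinv: "\<sigma> (inv_into UNIV \<sigma> i) = i" for i using s(1) by (simp add: bij_is_surj surj_f_inv_f)
  have Tinv: "T (inv_into UNIV T x) = x" for x using bT by (simp add: bij_is_surj surj_f_inv_f)
  have invT: "inv_into UNIV T (T x) = x" for x using bT by (simp add: bij_is_inj)
  have "(inv_into UNIV \<sigma>, inv_into UNIV T) \<in> carrier (spatial_symmetry_group E p)"
  proof -
    have "{inv_into UNIV \<sigma> i, inv_into UNIV \<sigma> j} \<in> E \<longleftrightarrow> {i, j} \<in> E" for i j
      using s(2)[of "inv_into UNIV \<sigma> i" "inv_into UNIV \<sigma> j"] sinv by simp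
    moreover have "dist (inv_into UNIV T x) (inv_into UNIV T y) = dist x y" for x y
      using T(1)[of "inv_into UNIV T x" "inv_into UNIV T y"] Tinv by simp
    moreover have "p (inv_into UNIV \<sigma> i) = inv_into UNIV T (p i)" for i
      using T(2)[of "inv_into UNIV \<sigma> i"] sinv invT by metis
    ultimately show ?thesis
      using s(1) by (simp add: spatial_symmetry_group_def bij_imp_bij_inv)
  qed
  moreover have "inv_into UNIV \<sigma> \<circ> \<sigma> = id" "inv_into UNIV T \<circ> T = id"
    using s(1) invT by (auto simp: bij_is_inj)
  ultimately show "\<exists>h\<in>carrier (spatial_symmetry_group E p).
      h \<otimes>\<^bsub>spatial_symmetry_group E p\<^esub> g = \<one>\<^bsub>spatial_symmetry_group E p\<^esub>"
    by (intro bexI[of _ "(inv_into UNIV \<sigma>, inv_into UNIV T)"])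
      (auto simp: spatial_symmetry_group_def g)
qed (auto simp: spatial_symmetry_group_def bij_comp comp_assoc)

definition permutation_matrix :: "('a::finite \<Rightarrow> 'a) \<Rightarrow> real ^ 'a ^ 'a" where
  "permutation_matrix \<pi> = (\<chi> i j. if i = \<pi> j then 1 else 0)"

definition kronecker :: "real ^ 'n ^ 'n \<Rightarrow> real ^ 'd ^ 'd \<Rightarrow> real ^ ('n::finite \<times> 'd) ^ ('n \<times> 'd)" where
  "kronecker A B = (\<chi> ik jl. A $ fst ik $ fst jl * B $ snd ik $ snd jl)"

definition rho_n :: "('n \<Rightarrow> 'n) \<times> (real ^ 'd \<Rightarrow> real ^ 'd) \<Rightarrow> real ^ 'n ^ 'n::finite" where
  "rho_n g = permutation_matrix (fst g)"

definition rho_sp :: "('n \<Rightarrow> 'n) \<times> (real ^ 'd \<Rightarrow> real ^ 'd) \<Rightarrow> real ^ 'd ^ 'd" where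
  "rho_sp g = matrix (\<lambda>x. snd g x - snd g 0)"

text \<open>Permutes all sets of joints; \<open>\<rho>\<^sub>e\<close> proper is its restriction to \<open>edge_space E\<close>.\<close>

definition rho_e :: "('n \<Rightarrow> 'n) \<times> (real ^ 'd \<Rightarrow> real ^ 'd) \<Rightarrow> real ^ ('n set) ^ ('n::finite set)" where
  "rho_e g = permutation_matrix (\<lambda>f. fst g ` f)"

definition rho_v ::
    "('n \<Rightarrow> 'n) \<times> (real ^ 'd \<Rightarrow> real ^ 'd) \<Rightarrow> real ^ ('n::finite \<times> 'd) ^ ('n \<times> 'd)" where
  "rho_v g = kronecker (rho_n g) (rho_sp g)"

end

theory Submission
  imports Defs
begin

text \<open>The rigidity matrix \<open>R\<close> intertwines the two representations: a symmetry permutes the bars and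
  turns bar directions and joint velocities by the same orthogonal matrix, so \<open>R \<rho>\<^sub>v(g) = \<rho>\<^sub>e(g) R\<close>.
  The character formula is the equivariant form of counting dimensions by rank and nullity.

  Both representations are orthogonal, so orthogonal complements of invariant subspaces are
  invariant and traces add up (\<open>trace_on_orthogonal_complement\<close>). On \<open>(ker R)\<^sup>\<bottom>\<close> the map \<open>R\<close> is an
  equivariant isomorphism onto its range, hence (\<open>trace_on_kernel_range\<close>)
  \<open>tr \<rho>\<^sub>v = tr (\<rho>\<^sub>v | ker R) + tr (\<rho>\<^sub>e | range R)\<close>.
  The kernel of \<open>R\<close> splits orthogonally into rigid flexes and mechanisms; the space of bars splits
  orthogonally into the range of \<open>R\<close> and the self stresses, since \<open>ker R\<^sup>* = (range R)\<^sup>\<bottom>\<close>. Eliminating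
  the trace on the range of \<open>R\<close> from these three identities, and using that the trace of a Kronecker
  product is the product of the traces, gives the formula.\<close>

section \<open>Additivity and invariance of the trace\<close>

text \<open>An injective map with \<open>f ` A \<subseteq> A\<close> is onto \<open>A\<close> in finite dimension, so every vector of \<open>A\<close> is an
  image from \<open>A\<close>, and \<open>f\<close> preserves inner products with it.\<close>

lemma orthogonal_comp_invariant:
  fixes f :: "'a::euclidean_space \<Rightarrow> 'a"
  assumes f: "orthogonal_transformation f" and A: "subspace A" "f ` A \<subseteq> A"
  shows "f ` orthogonal_comp A \<subseteq> orthogonal_comp A"
proof clarify
  fix x assume x: "x \<in> orthogonal_comp A"
  have lin: "linear f" using f by (rule orthogonal_transformation_linear)
  have "dim (f ` A) = dim A"
    by (rule dim_image_eq[OF lin])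
      (rule inj_on_subset[OF orthogonal_transformation_inj[OF f] subset_UNIV])
  hence fA: "f ` A = A"
    using A lin by (intro subspace_dim_equal) (auto intro: linear_subspace_image)
  have "orthogonal a (f x)" if "a \<in> A" for a
  proof -
    have "a \<in> f ` A" using that by (simp only: fA)
    then obtain a' where "a' \<in> A" "a = f a'" by blast
    thus ?thesis
      using x f by (auto simp: orthogonal_comp_def orthogonal_transformation_def orthogonal_def)
  qed
  thus "f x \<in> orthogonal_comp A" by (auto simp: orthogonal_comp_def)
qed

text \<open>A basis of \<open>A\<close> and one of its complement within \<open>S\<close> together form a basis of \<open>S\<close>, and the coefficients
  of a vector in one of the two parts do not change. Taking both bases orthonormal makes the
  independence of their union immediate.\<close>

lemma trace_on_orthogonal_complement:
  fixes f :: "'a::euclidean_space \<Rightarrow> 'a"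
  assumes f: "orthogonal_transformation f"
    and S: "subspace S" "f ` S \<subseteq> S" and A: "subspace A" "f ` A \<subseteq> A" and AS: "A \<subseteq> S"
  shows "trace_on S f = trace_on A f + trace_on (S \<inter> orthogonal_comp A) f"
proof -
  define C where "C = S \<inter> orthogonal_comp A"
  have lin: "linear f" using f by (rule orthogonal_transformation_linear)
  have C: "subspace C" unfolding C_def by (intro subspace_inter S subspace_orthogonal_comp)
  have fC: "f ` C \<subseteq> C"
    using orthogonal_comp_invariant[OF f A] S(2) by (auto simp: C_def)
  obtain BA where BA: "BA \<subseteq> A" "pairwise orthogonal BA" "\<And>x. x \<in> BA \<Longrightarrow> norm x = 1"
      "independent BA" "span BA = A"
    using orthonormal_basis_subspace[OF A(1)] by metis
  obtain BC where BC: "BC \<subseteq> C" "pairwise orthogonal BC" "\<And>x. x \<in> BC \<Longrightarrow> norm x = 1"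
      "independent BC" "span BC = C"
    using orthonormal_basis_subspace[OF C] by metis
  have cross: "orthogonal a c" if "a \<in> BA" "c \<in> BC" for a c
    using that BA(1) BC(1) by (auto simp: C_def orthogonal_comp_def)
  have disj: "BA \<inter> BC = {}"
  proof -
    have "norm b = 0" if "b \<in> BA" "b \<in> BC" for b
      using cross[OF that] by (simp add: orthogonal_def)
    thus ?thesis using BA(3) by fastforce
  qed
  have "pairwise orthogonal (BA \<union> BC)"
    unfolding pairwise_def
    using BA(2) BC(2) cross orthogonal_commute by (metis Un_iff pairwise_def)
  hence ind: "independent (BA \<union> BC)"
  proof (rule pairwise_orthogonal_independent)
    show "0 \<notin> BA \<union> BC" using BA(3)[of 0] BC(3)[of 0] by auto
  qed
  have span: "span (BA \<union> BC) = S"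
  proof
    show "span (BA \<union> BC) \<subseteq> S"
      using BA(1) BC(1) AS S(1) by (intro span_minimal) (auto simp: C_def)
    show "S \<subseteq> span (BA \<union> BC)"
    proof
      fix x assume x: "x \<in> S"
      have "x \<in> A + orthogonal_comp A" using subspace_sum_orthogonal_comp[OF A(1)] by auto
      then obtain a c where ac: "a \<in> A" "c \<in> orthogonal_comp A" "x = a + c" by (rule set_plus_elim)
      have "x - a \<in> S" using x ac(1) AS S(1) by (blast intro: subspace_diff)
      hence "c \<in> C" using ac by (simp add: C_def)
      thus "x \<in> span (BA \<union> BC)"
        using ac BA(5) BC(5) span_mono[of BA "BA \<union> BC"] span_mono[of BC "BA \<union> BC"]
        by (simp add: span_add subset_iff)
    qed
  qed
  have fin: "finite BA" "finite BC" using BA BC by (auto simp: independent_imp_finite)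
  have "trace_on S f = (\<Sum>b\<in>BA \<union> BC. representation (BA \<union> BC) (f b) b)"
    by (rule trace_on_basis[OF lin S(2) ind span])
  also have "\<dots> = (\<Sum>b\<in>BA. representation (BA \<union> BC) (f b) b)
      + (\<Sum>b\<in>BC. representation (BA \<union> BC) (f b) b)"
    by (rule sum.union_disjoint[OF fin disj])
  also have "(\<Sum>b\<in>BA. representation (BA \<union> BC) (f b) b) = (\<Sum>b\<in>BA. representation BA (f b) b)"
    using BA A(2) by (intro sum.cong refl fun_cong[OF representation_extend[OF ind]]) auto
  also have "\<dots> = trace_on A f"
    by (rule trace_on_basis[OF lin A(2) BA(4,5), symmetric])
  also have "(\<Sum>b\<in>BC. representation (BA \<union> BC) (f b) b) = (\<Sum>b\<in>BC. representation BC (f b) b)"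
    using BC fC by (intro sum.cong refl fun_cong[OF representation_extend[OF ind]]) auto
  also have "\<dots> = trace_on C f"
    by (rule trace_on_basis[OF lin fC BC(4,5), symmetric])
  finally show ?thesis unfolding C_def .
qed

text \<open>In terms of the basis \<open>h ` B\<close> of \<open>h ` S\<close>, the map \<open>k\<close> has the same matrix as \<open>f\<close> in terms of \<open>B\<close>.\<close>

lemma trace_on_conjugate:
  fixes f :: "'a::euclidean_space \<Rightarrow> 'a" and k :: "'b::euclidean_space \<Rightarrow> 'b" and h :: "'a \<Rightarrow> 'b"
  assumes f: "linear f" "f ` S \<subseteq> S" and S: "subspace S"
    and k: "linear k" and h: "linear h" "inj_on h S"
    and eq: "\<And>x. x \<in> S \<Longrightarrow> h (f x) = k (h x)"
  shows "trace_on (h ` S) k = trace_on S f"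
proof -
  obtain B where B: "B \<subseteq> S" "independent B" "span B = S"
    using basis_exists[of S] span_subspace[OF _ _ S] by metis
  have inj: "inj_on h B" using h(2) B(1) by (rule inj_on_subset)
  have fin: "finite B" using B(2) by (rule independent_imp_finite)
  have ind: "independent (h ` B)"
    using h B by (intro linear_independent_injective_image) auto
  have span: "span (h ` B) = h ` S" using B(3) linear_span_image[OF h(1)] by metis
  have kS: "k ` (h ` S) \<subseteq> h ` S" using f(2) eq by force
  have rep: "representation (h ` B) (h x) (h b) = representation B x b" if x: "x \<in> S" and b: "b \<in> B" for x b
  proof -
    have "h x = h (\<Sum>c\<in>B. representation B x c *\<^sub>R c)"
      using real_vector.sum_representation_eq[of B x B] B fin x by simp
    also have "\<dots> = (\<Sum>c\<in>B. representation B x c *\<^sub>R h c)"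
      using h by (simp add: linear_sum linear_cmul)
    finally have "representation (h ` B) (h x) (h b)
        = representation (h ` B) (\<Sum>c\<in>B. representation B x c *\<^sub>R h c) (h b)" by simp
    also have "\<dots> = (\<Sum>c\<in>B. representation (h ` B) (representation B x c *\<^sub>R h c) (h b))"
      using real_vector.representation_sum[of "h ` B" B "\<lambda>c. representation B x c *\<^sub>R h c"] ind
      by (auto simp: span_scale span_base)
    also have "\<dots> = (\<Sum>c\<in>B. if c = b then representation B x c else 0)"
      using ind inj b
      by (intro sum.cong refl)
        (auto simp: real_vector.representation_scale span_base real_vector.representation_basis inj_on_eq_iff)
    also have "\<dots> = representation B x b" using fin b by simp
    finally show ?thesis .
  qed
  have "trace_on (h ` S) k = (\<Sum>c\<in>h ` B. representation (h ` B) (k c) c)"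
    by (rule trace_on_basis[OF k kS ind span])
  also have "\<dots> = (\<Sum>b\<in>B. representation (h ` B) (k (h b)) (h b))"
    using inj by (simp add: sum.reindex)
  also have "\<dots> = (\<Sum>b\<in>B. representation B (f b) b)"
  proof (rule sum.cong[OF refl])
    fix b assume b: "b \<in> B"
    hence "b \<in> S" "f b \<in> S" using B(1) f(2) by auto
    thus "representation (h ` B) (k (h b)) (h b) = representation B (f b) b"
      using rep[of "f b" b] eq b by simp
  qed
  also have "\<dots> = trace_on S f"
    by (rule trace_on_basis[OF f B(2,3), symmetric])
  finally show ?thesis .
qed

text \<open>The equivariant rank-nullity theorem: \<open>h\<close> maps the orthogonal complement of its kernel
  isomorphically onto its range.\<close>

lemma trace_on_kernel_range:
  fixes f :: "'a::euclidean_space \<Rightarrow> 'a" and k :: "'b::euclidean_space \<Rightarrow> 'b" and h :: "'a \<Rightarrow> 'b"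
  assumes f: "orthogonal_transformation f" and k: "linear k" and h: "linear h"
    and eq: "\<And>x. h (f x) = k (h x)"
  shows "trace_on UNIV f = trace_on {x. h x = 0} f + trace_on (range h) k"
proof -
  define K where "K = {x. h x = 0}"
  have lin: "linear f" using f by (rule orthogonal_transformation_linear)
  have K: "subspace K" unfolding K_def by (rule linear_subspace_kernel[OF h])
  have fK: "f ` K \<subseteq> K" using eq linear_0[OF k] by (auto simp: K_def)
  have split: "trace_on UNIV f = trace_on K f + trace_on (orthogonal_comp K) f"
    using trace_on_orthogonal_complement[OF f subspace_UNIV subset_UNIV K fK subset_UNIV] by simp
  have fC: "f ` orthogonal_comp K \<subseteq> orthogonal_comp K"
    by (rule orthogonal_comp_invariant[OF f K fK])
  have inj: "inj_on h (orthogonal_comp K)"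
  proof (rule inj_onI)
    fix x y assume xy: "x \<in> orthogonal_comp K" "y \<in> orthogonal_comp K" "h x = h y"
    have "x - y \<in> K" using xy(3) h by (simp add: K_def linear_diff)
    moreover have "x - y \<in> orthogonal_comp K"
      using xy(1,2) by (intro subspace_diff subspace_orthogonal_comp)
    ultimately have "orthogonal (x - y) (x - y)" by (auto simp: orthogonal_comp_def)
    thus "x = y" by (simp add: orthogonal_def)
  qed
  have range: "h ` orthogonal_comp K = range h"
  proof
    show "range h \<subseteq> h ` orthogonal_comp K"
    proof clarify
      fix x
      have "x \<in> K + orthogonal_comp K" using subspace_sum_orthogonal_comp[OF K] by auto
      then obtain a c where "a \<in> K" "c \<in> orthogonal_comp K" "x = a + c" by (rule set_plus_elim)
      moreover from this have "h x = h c" using h by (simp add: K_def linear_add)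
      ultimately show "h x \<in> h ` orthogonal_comp K" by auto
    qed
  qed auto
  have "trace_on (h ` orthogonal_comp K) k = trace_on (orthogonal_comp K) f"
    by (rule trace_on_conjugate[OF lin fC subspace_orthogonal_comp k h inj eq])
  thus ?thesis using split range by (simp add: K_def)
qed

lemma trace_on_UNIV_matrix:
  fixes M :: "real ^ 'k ^ 'k"
  shows "trace_on UNIV ((*v) M) = trace M"
proof -
  have rep: "representation Basis x b = x \<bullet> b" if "b \<in> Basis" for x b :: "real ^ 'k"
    using fun_cong[OF representation_euclidean_space, of x b] that by simp
  have "trace_on UNIV ((*v) M) = (\<Sum>b\<in>Basis. representation Basis (M *v b) b)"
    by (intro trace_on_basis) (auto simp: independent_Basis)
  also have "\<dots> = (\<Sum>b\<in>Basis. (M *v b) \<bullet> b)"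
    by (rule sum.cong) (auto simp: rep)
  also have "\<dots> = (\<Sum>i\<in>UNIV. (M *v axis i 1) \<bullet> axis i 1)"
  proof -
    have inj: "inj (\<lambda>i. axis i (1::real) :: real ^ 'k)" by (auto simp: inj_def axis_eq_axis)
    have "(Basis :: (real ^ 'k) set) = (\<lambda>i. axis i 1) ` UNIV" by (auto simp: Basis_vec_def)
    thus ?thesis using sum.reindex[OF inj, of "\<lambda>b. (M *v b) \<bullet> b"] by simp
  qed
  also have "\<dots> = trace M"
    by (simp add: trace_def inner_axis matrix_vector_mul_component inner_axis)
  finally show ?thesis .
qed

lemma trace_kronecker: "trace (kronecker A B) = trace A * trace B"
proof -
  have "trace (kronecker A B) = (\<Sum>x\<in>UNIV \<times> UNIV. A $ fst x $ fst x * B $ snd x $ snd x)"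
    by (simp add: trace_def kronecker_def)
  also have "\<dots> = (\<Sum>i\<in>UNIV. \<Sum>k\<in>UNIV. A $ i $ i * B $ k $ k)"
    by (simp only: sum.cartesian_product case_prod_unfold)
  also have "\<dots> = trace A * trace B" by (simp add: trace_def sum_product)
  finally show ?thesis .
qed

section \<open>Joint velocities and bar coordinates\<close>

text \<open>Groups the coordinates of \<open>\<H>\<^sub>v\<close> by joints; in this form the action of a symmetry and the rows of
  the rigidity matrix have coordinate-free descriptions.\<close>

definition velocity :: "real ^ ('n::finite \<times> 'd) \<Rightarrow> 'n \<Rightarrow> real ^ 'd" where
  "velocity u i = (\<chi> k. u $ (i, k))"

lemma inner_velocity: "u \<bullet> w = (\<Sum>i\<in>UNIV. velocity u i \<bullet> velocity w i)"
proof -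
  have "u \<bullet> w = (\<Sum>x\<in>UNIV \<times> UNIV. u $ x * w $ x)" by (simp add: inner_vec_def)
  also have "\<dots> = (\<Sum>i\<in>UNIV. \<Sum>k\<in>UNIV. u $ (i, k) * w $ (i, k))"
    by (simp only: sum.cartesian_product case_prod_unfold prod.collapse)
  finally show ?thesis by (simp add: inner_vec_def velocity_def)
qed

text \<open>The row of a bar takes the velocities of its ends to half the derivative of their squared distance. This is the form in which invariance under isometries is visible.\<close>

lemma rigidity_matrix_bar:
  assumes "{i, j} \<in> E" "i \<noteq> j"
  shows "(rigidity_matrix E p *v u) $ {i, j} = (p i - p j) \<bullet> (velocity u i - velocity u j)"
proof -
  let ?q = "\<lambda>a. \<Sum>b\<in>{i, j} - {a}. p a - p b"
  have "(rigidity_matrix E p *v u) $ {i, j}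
      = (\<Sum>x\<in>UNIV \<times> UNIV. (if fst x \<in> {i, j} then ?q (fst x) $ snd x else 0) * u $ x)"
    using assms(1) by (simp add: rigidity_matrix_def matrix_vector_mult_def)
  also have "\<dots> = (\<Sum>a\<in>UNIV. \<Sum>k\<in>UNIV. (if a \<in> {i, j} then ?q a $ k else 0) * u $ (a, k))"
    by (simp only: sum.cartesian_product case_prod_unfold prod.collapse)
  also have "\<dots> = (\<Sum>a\<in>UNIV. if a \<in> {i, j} then ?q a \<bullet> velocity u a else 0)"
    by (intro sum.cong refl) (simp add: inner_vec_def velocity_def)
  also have "\<dots> = (\<Sum>a\<in>{i, j}. ?q a \<bullet> velocity u a)"
    by (rule sum.mono_neutral_cong_right) auto
  also have "\<dots> = (p i - p j) \<bullet> velocity u i + (p j - p i) \<bullet> velocity u j"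
  proof -
    have "{i, j} - {i} = {j}" "{i, j} - {j} = {i}" using assms(2) by auto
    thus ?thesis using assms(2) by simp
  qed
  finally show ?thesis by (simp add: algebra_simps inner_diff_left inner_diff_right)
qed

lemma rigidity_matrix_nonbar: "f \<notin> E \<Longrightarrow> (rigidity_matrix E p *v u) $ f = 0"
  by (simp add: rigidity_matrix_def matrix_vector_mult_def)

text \<open>Evaluating at \<open>\<pi> a\<close> avoids the inverse permutation; as \<open>\<pi>\<close> is onto, this describes all
  coordinates. The next lemma follows the same pattern.\<close>

lemma permutation_matrix_apply:
  assumes "bij \<pi>"
  shows "(permutation_matrix \<pi> *v w) $ \<pi> a = w $ a"
proof -
  have "(permutation_matrix \<pi> *v w) $ \<pi> a = (\<Sum>b\<in>UNIV. if a = b then w $ b else 0)"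
    using assms unfolding permutation_matrix_def matrix_vector_mult_def
    by (simp add: bij_is_inj inj_eq if_distrib[of "\<lambda>x. x * _"] cong: if_cong)
  thus ?thesis by simp
qed

lemma velocity_kronecker_permutation:
  assumes "bij \<sigma>"
  shows "velocity (kronecker (permutation_matrix \<sigma>) M *v u) (\<sigma> i) = M *v velocity u i"
proof -
  have "(kronecker (permutation_matrix \<sigma>) M *v u) $ (\<sigma> i, k) = (M *v velocity u i) $ k" for k
  proof -
    have "(kronecker (permutation_matrix \<sigma>) M *v u) $ (\<sigma> i, k)
        = (\<Sum>x\<in>UNIV \<times> UNIV. (if i = fst x then 1 else 0) * M $ k $ snd x * u $ x)"
      using assms
      by (simp add: kronecker_def permutation_matrix_def matrix_vector_mult_def bij_is_inj inj_eq)
    also have "\<dots> = (\<Sum>a\<in>UNIV. \<Sum>l\<in>UNIV. (if i = a then 1 else 0) * M $ k $ l * u $ (a, l))"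
      by (simp only: sum.cartesian_product case_prod_unfold prod.collapse)
    also have "\<dots> = (\<Sum>a\<in>UNIV. if i = a then \<Sum>l\<in>UNIV. M $ k $ l * u $ (a, l) else 0)"
      by (intro sum.cong refl) simp
    finally show ?thesis by (simp add: matrix_vector_mult_def velocity_def)
  qed
  thus ?thesis by (simp add: velocity_def vec_eq_iff)
qed

lemma orthogonal_transformation_permutation_matrix:
  assumes "bij \<pi>"
  shows "orthogonal_transformation ((*v) (permutation_matrix \<pi>))"
  unfolding orthogonal_transformation_def
proof (intro conjI allI)
  fix v w
  have "(permutation_matrix \<pi> *v v) \<bullet> (permutation_matrix \<pi> *v w)
      = (\<Sum>a\<in>UNIV. (permutation_matrix \<pi> *v v) $ \<pi> a * (permutation_matrix \<pi> *v w) $ \<pi> a)"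
    using sum.reindex_bij_betw[OF assms, of "\<lambda>a. (permutation_matrix \<pi> *v v) $ a * (permutation_matrix \<pi> *v w) $ a"]
    by (simp add: inner_vec_def)
  thus "(permutation_matrix \<pi> *v v) \<bullet> (permutation_matrix \<pi> *v w) = v \<bullet> w"
    by (simp add: permutation_matrix_apply[OF assms] inner_vec_def)
qed (rule matrix_vector_mul_linear)

lemma orthogonal_transformation_kronecker_permutation:
  assumes "bij \<sigma>" "orthogonal_transformation ((*v) M)"
  shows "orthogonal_transformation ((*v) (kronecker (permutation_matrix \<sigma>) M))"
  unfolding orthogonal_transformation_def
proof (intro conjI allI)
  fix v w
  let ?P = "kronecker (permutation_matrix \<sigma>) M"
  have "(?P *v v) \<bullet> (?P *v w) = (\<Sum>i\<in>UNIV. velocity (?P *v v) (\<sigma> i) \<bullet> velocity (?P *v w) (\<sigma> i))"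
    using sum.reindex_bij_betw[OF assms(1), of "\<lambda>i. velocity (?P *v v) i \<bullet> velocity (?P *v w) i"]
    by (simp add: inner_velocity)
  thus "(?P *v v) \<bullet> (?P *v w) = v \<bullet> w"
    using assms(2)
    by (simp add: velocity_kronecker_permutation[OF assms(1)] inner_velocity orthogonal_transformation_def)
qed (rule matrix_vector_mul_linear)

section \<open>Rigid motions\<close>

lemma matrix_vector_mult_minus: "(- A) *v x = - (A *v (x :: real ^ 'k))"
  by (simp add: matrix_vector_mult_def vec_eq_iff sum_negf)

lemma skew_symmetric_inner_self:
  fixes A :: "real ^ 'd ^ 'd"
  assumes "transpose A = - A"
  shows "x \<bullet> (A *v x) = 0"
proof -
  have "x \<bullet> (A *v x) = (transpose A *v x) \<bullet> x"
    by (simp add: dot_lmul_matrix transpose_matrix_vector)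
  also have "\<dots> = - (x \<bullet> (A *v x))"
    unfolding assms by (simp add: inner_commute matrix_vector_mult_minus)
  finally show ?thesis by simp
qed

lemma rigid_flexes_iff:
  "u \<in> rigid_flexes p \<longleftrightarrow> (\<exists>A b. transpose A = - A \<and> (\<forall>i. velocity u i = A *v p i + b))"
  by (force simp: rigid_flexes_def velocity_def vec_eq_iff)

lemma subspace_rigid_flexes: "subspace (rigid_flexes p)"
proof (rule subspaceI)
  show "0 \<in> rigid_flexes p"
    unfolding rigid_flexes_iff
    by (intro exI[of _ 0]) (simp add: velocity_def transpose_def vec_eq_iff)
next
  fix u w assume "u \<in> rigid_flexes p" "w \<in> rigid_flexes p"
  then obtain A b A' b' where skew: "transpose A = - A" "transpose A' = - A'"
      and vel: "\<And>i. velocity u i = A *v p i + b" "\<And>i. velocity w i = A' *v p i + b'"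
    unfolding rigid_flexes_iff by blast
  have "velocity (u + w) i = velocity u i + velocity w i" for i
    by (simp add: velocity_def vec_eq_iff)
  hence "velocity (u + w) i = (A + A') *v p i + (b + b')" for i
    by (simp add: vel matrix_vector_mult_add_rdistrib)
  moreover have "transpose (A + A') = - (A + A')"
  proof -
    have "transpose (A + A') = transpose A + transpose A'" by (simp add: transpose_def vec_eq_iff)
    thus ?thesis using skew by simp
  qed
  ultimately show "u + w \<in> rigid_flexes p" unfolding rigid_flexes_iff by blast
next
  fix c u assume "u \<in> rigid_flexes p"
  then obtain A b where skew: "transpose A = - A" and vel: "\<And>i. velocity u i = A *v p i + b"
    unfolding rigid_flexes_iff by auto
  have "velocity (c *\<^sub>R u) i = c *\<^sub>R velocity u i" for i
    by (simp add: velocity_def vec_eq_iff)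
  hence "velocity (c *\<^sub>R u) i = (c *\<^sub>R A) *v p i + c *\<^sub>R b" for i
    by (simp add: vel scaleR_add_right scaleR_matrix_vector_assoc)
  moreover have "transpose (c *\<^sub>R A) = - (c *\<^sub>R A)"
    using skew by (simp add: transpose_scalar)
  ultimately show "c *\<^sub>R u \<in> rigid_flexes p" unfolding rigid_flexes_iff by blast
qed

text \<open>A skew-symmetric \<open>A\<close> moves \<open>p i - p j\<close> orthogonally to itself, and the translation cancels in the
  difference of velocities.\<close>

lemma rigid_flexes_subset_inf_flexes:
  assumes "\<forall>e\<in>E. card e = 2"
  shows "rigid_flexes p \<subseteq> inf_flexes E p"
proof
  fix u assume "u \<in> rigid_flexes p"
  then obtain A b where A: "transpose A = - A" and u: "\<And>i. velocity u i = A *v p i + b"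
    unfolding rigid_flexes_iff by auto
  have "(rigidity_matrix E p *v u) $ f = 0" for f
  proof (cases "f \<in> E")
    case True
    then obtain i j where f: "f = {i, j}" "i \<noteq> j" using assms by (meson card_2_iff)
    have "velocity u i - velocity u j = A *v (p i - p j)"
      by (simp add: u matrix_vector_mult_diff_distrib)
    thus ?thesis
      using True f skew_symmetric_inner_self[OF A] by (simp add: rigidity_matrix_bar)
  qed (rule rigidity_matrix_nonbar)
  thus "u \<in> inf_flexes E p" by (simp add: inf_flexes_def vec_eq_iff)
qed

text \<open>This is \<open>ker R\<^sup>* = (range R)\<^sup>\<bottom>\<close>, and it makes the self stresses a complement inside the space of
  bars.\<close>

lemma self_stresses_eq:
  "self_stresses E p = edge_space E \<inter> orthogonal_comp (range ((*v) (rigidity_matrix E p)))"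
proof -
  let ?R = "rigidity_matrix E p"
  have "transpose ?R *v w = 0 \<longleftrightarrow> (\<forall>u. orthogonal (?R *v u) w)" for w
  proof -
    have "orthogonal (?R *v u) w \<longleftrightarrow> (transpose ?R *v w) \<bullet> u = 0" for u
      by (simp add: orthogonal_def dot_lmul_matrix transpose_matrix_vector inner_commute[of _ w])
    thus ?thesis by (metis inner_eq_zero_iff inner_zero_left)
  qed
  thus ?thesis by (auto simp: self_stresses_def orthogonal_comp_def)
qed

section \<open>The character formula\<close>

theorem theorem3p1:
  fixes E :: "'n::finite set set" and p :: "'n \<Rightarrow> real ^ 'd"
  assumes "bar_joint_framework E p"
  shows "\<forall>g \<in> carrier (spatial_symmetry_group E p).
           trace_on (mech_flexes E p) ((*v) (rho_v g))
             - trace_on (self_stresses E p) ((*v) (rho_e g))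
         = trace (rho_n g) * trace (rho_sp g)
             - trace_on (edge_space E) ((*v) (rho_e g))
             - trace_on (rigid_flexes p) ((*v) (rho_v g))"
proof
  fix g assume "g \<in> carrier (spatial_symmetry_group E p)"
  then obtain \<sigma> T where g: "g = (\<sigma>, T)" and s: "bij \<sigma>"
      and sE: "\<And>i j. {\<sigma> i, \<sigma> j} \<in> E \<longleftrightarrow> {i, j} \<in> E"
      and T: "\<And>x y. dist (T x) (T y) = dist x y" and pT: "\<And>i. p (\<sigma> i) = T (p i)"
    by (auto simp: spatial_symmetry_group_def)
  have E2: "\<forall>e\<in>E. card e = 2" using assms by (simp add: bar_joint_framework_def)
  let ?R = "rigidity_matrix E p" and ?P = "rho_v g" and ?Q = "rho_e g"
  define M where "M = rho_sp g"
  have oT: "orthogonal_transformation (\<lambda>x. T x - T 0)"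
    unfolding orthogonal_transformation_isometry using T by (simp add: dist_norm)
  have M: "M *v x = T x - T 0" for x
    using orthogonal_transformation_linear[OF oT] by (simp add: M_def rho_sp_def g matrix_works)
  have oM: "orthogonal_transformation ((*v) M)" using oT unfolding M[abs_def] .
  have Mp: "p (\<sigma> i) = M *v p i + T 0" for i by (simp add: M pT)
  have P: "?P = kronecker (permutation_matrix \<sigma>) M" by (simp add: rho_v_def rho_n_def M_def g)
  have Q: "?Q = permutation_matrix ((`) \<sigma>)" by (simp add: rho_e_def g)
  have bs: "bij ((`) \<sigma>)"
    using bij_betw_Pow[OF s] by simp
  have oP: "orthogonal_transformation ((*v) ?P)"
    unfolding P by (rule orthogonal_transformation_kronecker_permutation[OF s oM])
  have oQ: "orthogonal_transformation ((*v) ?Q)"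
    unfolding Q by (rule orthogonal_transformation_permutation_matrix[OF bs])
  have vP: "velocity (?P *v u) (\<sigma> i) = M *v velocity u i" for u i
    unfolding P by (rule velocity_kronecker_permutation[OF s])
  have vQ: "(?Q *v w) $ (\<sigma> ` f) = w $ f" for w f
    unfolding Q by (rule permutation_matrix_apply[OF bs])
  have surj: "\<exists>f. f' = \<sigma> ` f" for f' using bij_is_surj[OF bs] by (rule surjD)
  \<comment> \<open>The symmetry condition speaks of pairs \<open>{i, j}\<close> only; all bars are of this form.\<close>
  have edge: "\<sigma> ` f \<in> E \<longleftrightarrow> f \<in> E" for f
  proof -
    have "card (\<sigma> ` f) = card f"
      by (rule card_image) (rule inj_on_subset[OF bij_is_inj[OF s] subset_UNIV])
    hence "card f = 2" if "\<sigma> ` f \<in> E \<or> f \<in> E" using that E2 by auto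
    thus ?thesis using sE by (metis card_2_iff image_empty image_insert)
  qed

  have RP: "?R *v (?P *v u) = ?Q *v (?R *v u)" for u
  proof -
    have "(?R *v (?P *v u)) $ (\<sigma> ` f) = (?Q *v (?R *v u)) $ (\<sigma> ` f)" for f
    proof (cases "f \<in> E")
      case True
      then obtain i j where f: "f = {i, j}" "i \<noteq> j" using E2 by (meson card_2_iff)
      have ne: "\<sigma> i \<noteq> \<sigma> j" using f(2) s by (simp add: bij_is_inj inj_eq)
      have "(?R *v (?P *v u)) $ {\<sigma> i, \<sigma> j}
          = (M *v (p i - p j)) \<bullet> (M *v (velocity u i - velocity u j))"
        using True f ne sE by (simp add: rigidity_matrix_bar vP Mp matrix_vector_mult_diff_distrib)
      also have "\<dots> = (p i - p j) \<bullet> (velocity u i - velocity u j)"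
        using oM by (simp add: orthogonal_transformation_def)
      also have "\<dots> = (?R *v u) $ f" using True f by (simp add: rigidity_matrix_bar)
      finally show ?thesis using f vQ[of "?R *v u" f] by simp
    next
      case False
      thus ?thesis using edge by (simp add: vQ rigidity_matrix_nonbar)
    qed
    thus ?thesis using surj by (metis vec_eq_iff)
  qed

  have rig: "(*v) ?P ` rigid_flexes p \<subseteq> rigid_flexes p"
  proof clarify
    fix u assume "u \<in> rigid_flexes p"
    then obtain A b where A: "transpose A = - A" and u: "\<And>i. velocity u i = A *v p i + b"
      unfolding rigid_flexes_iff by auto
    \<comment> \<open>Conjugating the velocity field \<open>x \<mapsto> A x + b\<close> by the isometry \<open>T x = M x + T 0\<close> gives the field
      with linear part \<open>M A M\<^sup>T\<close>; the constant term absorbs the displacement \<open>T 0\<close>.\<close>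
    let ?A = "M ** A ** transpose M"
    have orth: "transpose M ** M = mat 1"
      using oM by (simp add: orthogonal_transformation_matrix orthogonal_matrix)
    have skew: "transpose ?A = - ?A"
    proof -
      have "transpose ?A = M ** (- A) ** transpose M"
        by (simp add: matrix_transpose_mul matrix_mul_assoc A)
      also have "\<dots> = - ?A"
        by (simp add: matrix_eq matrix_vector_mult_minus linear_neg[OF matrix_vector_mul_linear] flip: matrix_vector_mul_assoc)
      finally show ?thesis .
    qed
    have v: "velocity (?P *v u) (\<sigma> i) = ?A *v p (\<sigma> i) + (M *v b - ?A *v T 0)" for i
    proof -
      have "?A *v (M *v p i) = (M ** A ** (transpose M ** M)) *v p i"
        by (simp add: matrix_vector_mul_assoc matrix_mul_assoc)
      also have "\<dots> = M *v (A *v p i)" by (simp add: orth matrix_vector_mul_assoc)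
      finally show ?thesis by (simp add: vP u Mp matrix_vector_right_distrib)
    qed
    have "velocity (?P *v u) i = ?A *v p i + (M *v b - ?A *v T 0)" for i
      using v bij_is_surj[OF s] by (metis surjD)
    thus "?P *v u \<in> rigid_flexes p" unfolding rigid_flexes_iff using skew by blast
  qed

  have fl: "subspace (inf_flexes E p)" "(*v) ?P ` inf_flexes E p \<subseteq> inf_flexes E p"
  proof -
    show "subspace (inf_flexes E p)"
      unfolding inf_flexes_def by (rule linear_subspace_kernel) (rule matrix_vector_mul_linear)
    show "(*v) ?P ` inf_flexes E p \<subseteq> inf_flexes E p" by (auto simp: inf_flexes_def RP)
  qed
  have es: "subspace (edge_space E)" "(*v) ?Q ` edge_space E \<subseteq> edge_space E"
  proof -
    show "subspace (edge_space E)" by (auto simp: edge_space_def subspace_def)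
    show "(*v) ?Q ` edge_space E \<subseteq> edge_space E"
      unfolding edge_space_def using edge surj vQ by clarsimp metis
  qed
  have rg: "subspace (range ((*v) ?R))" "(*v) ?Q ` range ((*v) ?R) \<subseteq> range ((*v) ?R)"
      "range ((*v) ?R) \<subseteq> edge_space E"
  proof -
    show "subspace (range ((*v) ?R))"
      by (rule linear_subspace_image[OF matrix_vector_mul_linear subspace_UNIV])
    show "(*v) ?Q ` range ((*v) ?R) \<subseteq> range ((*v) ?R)" by (auto simp flip: RP)
    show "range ((*v) ?R) \<subseteq> edge_space E" by (auto simp: edge_space_def rigidity_matrix_nonbar)
  qed

  have "trace (rho_n g) * trace (rho_sp g) = trace_on UNIV ((*v) ?P)"
    by (simp add: trace_on_UNIV_matrix rho_v_def trace_kronecker)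
  also have "\<dots> = trace_on (inf_flexes E p) ((*v) ?P) + trace_on (range ((*v) ?R)) ((*v) ?Q)"
    unfolding inf_flexes_def
    by (rule trace_on_kernel_range[OF oP matrix_vector_mul_linear matrix_vector_mul_linear RP])
  finally have 1: "trace (rho_n g) * trace (rho_sp g) = \<dots>" .
  have 2: "trace_on (inf_flexes E p) ((*v) ?P)
      = trace_on (rigid_flexes p) ((*v) ?P) + trace_on (mech_flexes E p) ((*v) ?P)"
    unfolding mech_flexes_def
    by (rule trace_on_orthogonal_complement[OF oP fl subspace_rigid_flexes rig
          rigid_flexes_subset_inf_flexes[OF E2]])
  have 3: "trace_on (edge_space E) ((*v) ?Q)
      = trace_on (range ((*v) ?R)) ((*v) ?Q) + trace_on (self_stresses E p) ((*v) ?Q)"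
    unfolding self_stresses_eq
    by (rule trace_on_orthogonal_complement[OF oQ es rg])
  show "trace_on (mech_flexes E p) ((*v) ?P) - trace_on (self_stresses E p) ((*v) ?Q)
      = trace (rho_n g) * trace (rho_sp g) - trace_on (edge_space E) ((*v) ?Q)
        - trace_on (rigid_flexes p) ((*v) ?P)"
    using 1 2 3 by simp
qed

end
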